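(* Let $\widehat{A}=A+\epsilon B\in\mathbb{DR}^{n\times n}$ with $\operatorname{Ind}(A)=m$, and let $\widehat{b}\in\mathbb{DR}^n$. Assume that the dual core-EP generalized inverse $\widehat{A}^{\dagger_c}$ exists and $\widehat{A}^{\dagger_c}=A^{\dagger_c}-\epsilon A^{\dagger_c}BA^{\dagger_c}$. Then the unique solution $\widehat{x}$ of $$\widehat{A}\widehat{A}^{\dagger_c}\widehat{x}=\widehat{A}^{\dagger_c}\widehat{b}$$ in the range $\mathscr{R}(\widehat{A}^{m})$ is given by $\widehat{x}=\widehat{A}^{\dagger_c}\widehat{b}$.
   Context: Dual numbers are $a+\epsilon b$ with $a,b\in\mathbb{R}$, $\epsilon\neq 0$, $\epsilon^2=0$. $\mathbb{DR}^{n\times n}$ (resp. $\mathbb{DR}^n$) is the set of dual real matrices $\widehat{A}=A+\epsilon B$ (resp. vectors), with product $(A+\epsilon B)(C+\epsilon D)=AC+\epsilon(AD+BC)$ and transpose $(A+\epsilon B)^T=A^T+\epsilon B^T$. $\operatorname{Ind}(A)$ is the smallest nonnegative integer $s$ with $\operatorname{rank}(A^{s+1})=\operatorname{rank}(A^s)$. The range of a dual matrix $\widehat{C}$ is $\mathscr{R}(\widehat{C})=\{\widehat{C}\widehat{x}:\widehat{x}\in\mathbb{DR}^n\}$. For a real square matrix $A$ of index $m$, the core-EP inverse $A^{\dagger_c}$ is the unique real $X$ with $(AX)^T=AX$, $AX^2=X$, $XA^{m+1}=A^m$. For $\widehat{A}=A+\epsilon B$ with $\operatorname{Ind}(A)=m$,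 the dual core-EP generalized inverse $\widehat{A}^{\dagger_c}$ is the $\widehat{X}\in\mathbb{DR}^{n\times n}$ (unique if it exists) with $(\widehat{A}\widehat{X})^{T}=\widehat{A}\widehat{X}$, $\widehat{A}\widehat{X}^{2}=\widehat{X}$, $\widehat{X}\widehat{A}^{m+1}=\widehat{A}^{m}$. *)

theory Defs
  imports "HOL-Analysis.Analysis"
begin

datatype dual = Dual (std: real) (inf_part: real)

instantiation dual :: comm_ring_1
begin

definition zero_dual :: dual where "0 = Dual 0 0"
definition one_dual :: dual where "1 = Dual 1 0"
definition plus_dual :: "dual \<Rightarrow> dual \<Rightarrow> dual"
  where "x + y = Dual (std x + std y) (inf_part x + inf_part y)"
definition minus_dual :: "dual \<Rightarrow> dual \<Rightarrow> dual"
  where "x - y = Dual (std x - std y) (inf_part x - inf_part y)"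
definition uminus_dual :: "dual \<Rightarrow> dual"
  where "- x = Dual (- std x) (- inf_part x)"
definition times_dual :: "dual \<Rightarrow> dual \<Rightarrow> dual"
  where "x * y = Dual (std x * std y) (std x * inf_part y + inf_part x * std y)"

instance
  by standard
    (auto simp: zero_dual_def one_dual_def plus_dual_def minus_dual_def
      uminus_dual_def times_dual_def algebra_simps)

end

lemmas dual_defs = zero_dual_def one_dual_def plus_dual_def minus_dual_def
  uminus_dual_def times_dual_def

definition dual_eps :: dual where "dual_eps = Dual 0 1"

definition dual_of_real :: "real \<Rightarrow> dual" where "dual_of_real a = Dual a 0"

lemma dual_eps_nonzero: "dual_eps \<noteq> 0"
  and dual_eps_square: "dual_eps * dual_eps = 0"
  and Dual_eq: "Dual a b = dual_of_real a + dual_eps * dual_of_real b"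
  by (auto simp: dual_eps_def dual_of_real_def dual_defs)

lemma std_simps [simp]:
  "std 0 = 0" "std 1 = 1" "std (x + y) = std x + std y" "std (x * y) = std x * std y"
  by (auto simp: dual_defs)

lemma inf_part_simps [simp]:
  "inf_part 0 = 0" "inf_part 1 = 0" "inf_part (x + y) = inf_part x + inf_part y"
  "inf_part (x * y) = std x * inf_part y + inf_part x * std y"
  by (auto simp: dual_defs)

lemma std_sum: "std (sum f S) = (\<Sum>i\<in>S. std (f i))"
  by (induction S rule: infinite_finite_induct) auto

lemma inf_part_sum: "inf_part (sum f S) = (\<Sum>i\<in>S. inf_part (f i))"
  by (induction S rule: infinite_finite_induct) auto

text \<open>Dual matrices are matrices over the ring of dual numbers, so that the library's
  product and transpose apply; \<open>dual_mat A B\<close> is \<open>A + \<epsilon>B\<close>.\<close>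

definition dual_mat :: "real^'n^'m \<Rightarrow> real^'n^'m \<Rightarrow> dual^'n^'m"
  where "dual_mat A B = (\<chi> i j. Dual (A $ i $ j) (B $ i $ j))"

definition std_mat :: "dual^'n^'m \<Rightarrow> real^'n^'m"
  where "std_mat M = (\<chi> i j. std (M $ i $ j))"

lemma std_mat_dual_mat [simp]: "std_mat (dual_mat A B) = A"
  by (simp add: std_mat_def dual_mat_def vec_eq_iff)

lemma dual_mat_surj: "\<exists>A B. M = dual_mat A B"
  by (rule exI[of _ "std_mat M"], rule exI[of _ "\<chi> i j. inf_part (M $ i $ j)"])
    (simp add: std_mat_def dual_mat_def vec_eq_iff)

lemma dual_mat_mult:
  "dual_mat A B ** dual_mat C D = dual_mat (A ** C) (A ** D + B ** C)"
  by (auto simp: dual_mat_def matrix_matrix_mult_def vec_eq_iff dual.expand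
      std_sum inf_part_sum sum.distrib intro!: dual.expand)

lemma dual_mat_transpose: "transpose (dual_mat A B) = dual_mat (transpose A) (transpose B)"
  by (simp add: dual_mat_def transpose_def)

primrec matpow :: "'a::semiring_1^'n^'n \<Rightarrow> nat \<Rightarrow> 'a^'n^'n"
  where
    "matpow A 0 = mat 1"
  | "matpow A (Suc k) = A ** matpow A k"

definition mat_index :: "real^'n^'n \<Rightarrow> nat"
  where "mat_index A = (LEAST s. rank (matpow A (s + 1)) = rank (matpow A s))"

definition mat_range :: "'a::semiring_1^'n^'m \<Rightarrow> ('a^'m) set"
  where "mat_range C = range (\<lambda>x. C *v x)"

text \<open>The system of equations is the same over the reals and over the dual numbers;
  in the dual case \<open>m\<close> is the index of the standard part.\<close>

definition core_EP_eqs :: "nat \<Rightarrow> 'a::comm_ring_1^'n^'n \<Rightarrow> 'a^'n^'n \<Rightarrow> bool"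
  where "core_EP_eqs m A X \<longleftrightarrow>
    transpose (A ** X) = A ** X \<and>
    A ** (X ** X) = X \<and>
    X ** matpow A (m + 1) = matpow A m"

definition is_core_EP_inverse :: "real^'n^'n \<Rightarrow> real^'n^'n \<Rightarrow> bool"
  where "is_core_EP_inverse A X \<longleftrightarrow> core_EP_eqs (mat_index A) A X"

definition core_EP_inverse :: "real^'n^'n \<Rightarrow> real^'n^'n"
  where "core_EP_inverse A = (THE X. is_core_EP_inverse A X)"

definition is_dual_core_EP_inverse :: "dual^'n^'n \<Rightarrow> dual^'n^'n \<Rightarrow> bool"
  where "is_dual_core_EP_inverse A X \<longleftrightarrow> core_EP_eqs (mat_index (std_mat A)) A X"

definition dual_core_EP_inverse :: "dual^'n^'n \<Rightarrow> dual^'n^'n"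
  where "dual_core_EP_inverse A = (THE X. is_dual_core_EP_inverse A X)"

lemma matpow_commute: "A ** matpow A k = matpow A k ** A"
  by (induction k) (simp_all, metis matrix_mul_assoc)

lemma core_EP_eqs_powers:
  assumes "core_EP_eqs m A X"
  shows "X = matpow A k ** matpow X (Suc k)"
proof (induction k)
  case (Suc k)
  have X: "A ** (X ** X) = X"
    using assms by (simp add: core_EP_eqs_def)
  have "matpow A (Suc k) ** matpow X (Suc (Suc k)) =
      matpow A k ** A ** (X ** (X ** matpow X k))"
    by (simp only: matpow.simps matpow_commute[of A])
  also have "\<dots> = matpow A k ** ((A ** (X ** X)) ** matpow X k)"
    by (simp add: matrix_mul_assoc)
  finally have "matpow A (Suc k) ** matpow X (Suc (Suc k)) =
      matpow A k ** ((A ** (X ** X)) ** matpow X k)" .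
  then show ?case
    using Suc X by simp
qed simp

lemma core_EP_eqs_unique:
  fixes A X Y :: "'a::comm_ring_1^'n^'n"
  assumes X: "core_EP_eqs m A X" and Y: "core_EP_eqs m A Y"
  shows "X = Y"
proof -
  have XA: "X ** (A ** Z) = Z"
    if W: "core_EP_eqs m A X" and Z: "core_EP_eqs m A Z" for X Z :: "'a^'n^'n"
  proof -
    have "X ** (A ** Z) = X ** matpow A (m + 1) ** matpow Z (Suc m)"
      by (subst core_EP_eqs_powers[OF Z, of m]) (simp add: matrix_mul_assoc)
    also have "\<dots> = matpow A m ** matpow Z (Suc m)"
      using W by (simp add: core_EP_eqs_def)
    finally show ?thesis
      using core_EP_eqs_powers[OF Z, of m] by simp
  qed
  have AXAY: "A ** X = A ** Y"
  proof -
    have "A ** X = transpose (A ** X)"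
      using X by (simp add: core_EP_eqs_def)
    also have "\<dots> = transpose ((A ** Y) ** (A ** X))"
      by (simp add: XA[OF Y X] flip: matrix_mul_assoc)
    also have "\<dots> = (A ** X) ** (A ** Y)"
      using X Y by (simp add: matrix_transpose_mul core_EP_eqs_def)
    also have "\<dots> = A ** Y"
      by (simp add: XA[OF X Y] flip: matrix_mul_assoc)
    finally show ?thesis .
  qed
  have "X = X ** (A ** X)"
    by (simp add: XA[OF X X])
  also have "\<dots> = Y"
    by (simp add: AXAY XA[OF X Y])
  finally show ?thesis .
qed

lemma core_EP_inverse_eq: "is_core_EP_inverse A X \<Longrightarrow> core_EP_inverse A = X"
  unfolding core_EP_inverse_def is_core_EP_inverse_def
  by (rule the_equality) (auto intro: core_EP_eqs_unique)

lemma dual_core_EP_inverse_eq: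
  "is_dual_core_EP_inverse A X \<Longrightarrow> dual_core_EP_inverse A = X"
  unfolding dual_core_EP_inverse_def is_dual_core_EP_inverse_def
  by (rule the_equality) (auto intro: core_EP_eqs_unique)

lemma std_mat_mult: "std_mat (M ** N) = std_mat M ** std_mat N"
  by (simp add: std_mat_def matrix_matrix_mult_def vec_eq_iff std_sum)

lemma std_mat_matpow: "std_mat (matpow M k) = matpow (std_mat M) k"
proof (induction k)
  case 0
  show ?case by (simp add: std_mat_def mat_def vec_eq_iff)
qed (simp add: std_mat_mult)

lemma std_mat_transpose: "std_mat (transpose M) = transpose (std_mat M)"
  by (simp add: std_mat_def transpose_def)

lemma is_core_EP_inverse_std_mat:
  assumes "is_dual_core_EP_inverse M X"
  shows "is_core_EP_inverse (std_mat M) (std_mat X)"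
  using assms unfolding is_core_EP_inverse_def is_dual_core_EP_inverse_def core_EP_eqs_def
  by (metis std_mat_mult std_mat_matpow std_mat_transpose)

end

theory Submission
  imports Defs
begin

text \<open>Let \<open>X\<close> satisfy the core-EP equations for \<open>A\<close> with exponent \<open>m\<close>. Then \<open>A X\<close> is a
  projector onto the range of \<open>A\<^sup>m\<close>, and the columns of \<open>X\<close> lie in that range because
  \<open>X = A\<^sup>m X\<^sup>m\<^sup>+\<^sup>1\<close>. For \<open>x\<close> in this range the equation \<open>A X x = X b\<close> therefore
  collapses to \<open>x = X b\<close>, and \<open>X b\<close> is itself an admissible \<open>x\<close>. All of this is
  matrix algebra over an arbitrary commutative ring; dual numbers enter only in the
  final instantiation.\<close>

text \<open>\<open>A\<^sup>m = X A\<^sup>m\<^sup>+\<^sup>1\<close> brings in a factor \<open>X\<close>, and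
  \<open>A X\<^sup>2 = X\<close> absorbs \<open>A X\<close> into it.\<close>

lemma core_EP_eqs_projector_fixes_matpow:
  fixes A X :: "'a::comm_ring_1^'n^'n"
  assumes "core_EP_eqs m A X"
  shows "A ** X ** matpow A m = matpow A m"
proof -
  have AXX: "A ** (X ** X) = X" and XA: "X ** matpow A (m + 1) = matpow A m"
    using assms by (simp_all only: core_EP_eqs_def)
  have "A ** X ** matpow A m = A ** X ** (X ** matpow A (m + 1))"
    by (simp only: XA)
  also have "\<dots> = A ** (X ** X) ** matpow A (m + 1)"
    by (simp only: matrix_mul_assoc)
  finally show ?thesis
    by (simp only: AXX XA)
qed

lemma core_EP_eqs_projector_fixes_range:
  fixes A X :: "'a::comm_ring_1^'n^'n"
  assumes "core_EP_eqs m A X" and "x \<in> mat_range (matpow A m)"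
  shows "(A ** X) *v x = x"
  using assms by (auto simp: mat_range_def matrix_vector_mul_assoc
      core_EP_eqs_projector_fixes_matpow)

lemma core_EP_eqs_mult_vec_in_range:
  fixes A X :: "'a::comm_ring_1^'n^'n"
  assumes "core_EP_eqs m A X"
  shows "X *v b \<in> mat_range (matpow A m)"
proof -
  have "X *v b = matpow A m *v (matpow X (Suc m) *v b)"
    by (subst core_EP_eqs_powers[OF assms, of m])
      (simp only: matrix_vector_mul_assoc)
  then show ?thesis
    by (auto simp: mat_range_def)
qed

lemma core_EP_eqs_solution_iff:
  fixes A X :: "'a::comm_ring_1^'n^'n"
  assumes "core_EP_eqs m A X"
  shows "x \<in> mat_range (matpow A m) \<and> (A ** X) *v x = X *v b \<longleftrightarrow> x = X *v b"
  using core_EP_eqs_projector_fixes_range[OF assms] core_EP_eqs_mult_vec_in_range[OF assms]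
  by metis

theorem theorem5p8:
  fixes A B :: "real^'n^'n" and Ah :: "dual^'n^'n" and bh :: "dual^'n" and m :: nat
  assumes "Ah = dual_mat A B"
    and "mat_index A = m"
    and "\<exists>X. is_dual_core_EP_inverse Ah X"
    and "dual_core_EP_inverse Ah =
      dual_mat (core_EP_inverse A) (- (core_EP_inverse A ** B ** core_EP_inverse A))"
  shows "(\<exists>!x. x \<in> mat_range (matpow Ah m) \<and>
            (Ah ** dual_core_EP_inverse Ah) *v x = dual_core_EP_inverse Ah *v bh)
    \<and> (\<forall>x. x \<in> mat_range (matpow Ah m) \<and>
            (Ah ** dual_core_EP_inverse Ah) *v x = dual_core_EP_inverse Ah *v bh
          \<longrightarrow> x = dual_core_EP_inverse Ah *v bh)"
proof -
  have "is_dual_core_EP_inverse Ah (dual_core_EP_inverse Ah)"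
    using assms(3) by (auto simp: dual_core_EP_inverse_eq)
  then have "core_EP_eqs m Ah (dual_core_EP_inverse Ah)"
    using assms(1,2) by (simp add: is_dual_core_EP_inverse_def)
  then show ?thesis
    by (simp add: core_EP_eqs_solution_iff)
qed

end
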